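(* Let $\mathcal{A}\in\mathbb{R}^{n_1\times\cdots\times n_d}$ be an order-$d$ real tensor and suppose $$\mathcal{A}=\sum_{i=1}^r u_i^{(1)}\circ u_i^{(2)}\circ\cdots\circ u_i^{(d)}$$ where $u_1^{(k)},\ldots,u_r^{(k)}\in\mathbb{R}^{n_k}$ for $k=1,\ldots,d$. Then $$\mathbf{sym}(\mathcal{A})=\sum_{\mathbf{p}\in S_d}\sum_{i=1}^r \pi\big(u_i^{(1)}\circ u_i^{(2)}\circ\cdots\circ u_i^{(d)}\big)^{<\mathbf{p}>},$$ where $S_d$ is the set of all permutations of $1,\ldots,d$.
   Context: An order-$d$ tensor $\mathcal{A}\in\mathbb{R}^{n_1\times\cdots\times n_d}$ is a real $d$-dimensional array with entries $\mathcal{A}(i_1,\ldots,i_d)$, $1\le i_k\le n_k$. Outer product: for $t_k\in\mathbb{R}^{n_k}$, $\mathcal{T}=t_1\circ\cdots\circ t_d\in\mathbb{R}^{n_1\times\cdots\times n_d}$ is the tensor with $\mathcal{T}(i_1,\ldots,i_d)=t_1(i_1)\cdots t_d(i_d)$. Transposition: for a permutation $\mathbf{p}=[p_1,\ldots,p_d]$ of $1,\ldots,d$, $\mathcal{A}^{<\mathbf{p}>}\in\mathbb{R}^{n_{p_1}\times\cdots\times n_{p_d}}$ is defined by $\mathcal{A}^{<\mathbf{p}>}(j_{p_1},\ldots,j_{p_d})=\mathcal{A}(j_1,\ldots,j_d)$ for $1\le j_k\le n_k$. Symmetric embedding: let $N=n_1+\cdots+n_d$ and partition the index range $1,\ldots,N$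 into consecutive ranges $\mathbf{r}_1,\ldots,\mathbf{r}_d$ with $\mathbf{r}_k = (1+n_1+\cdots+n_{k-1}),\ldots,(n_1+\cdots+n_k)$. Then $\mathcal{C}=\mathbf{sym}(\mathcal{A})$ is the order-$d$ tensor in $\mathbb{R}^{N\times\cdots\times N}$ whose blocks $\mathcal{C}_{\mathbf{i}}=\mathcal{C}(\mathbf{r}_{i_1},\ldots,\mathbf{r}_{i_d})$, $1\le i_k\le d$, are $\mathcal{C}_{\mathbf{i}}=\mathcal{A}^{<\mathbf{i}>}$ if $\mathbf{i}=[i_1,\ldots,i_d]$ is a permutation of $1,\ldots,d$, and $\mathcal{C}_{\mathbf{i}}=0$ otherwise. The map $\pi$: for $\mathcal{T}=t_1\circ\cdots\circ t_d\in\mathbb{R}^{n_1\times\cdots\times n_d}$ with $t_k\in\mathbb{R}^{n_k}$, $\pi(\mathcal{T})=s_1\circ\cdots\circ s_d\in\mathbb{R}^{N\times\cdots\times N}$, where $s_k\in\mathbb{R}^N$ is obtained from $t_k$ by padding with zeros: $s_k$ consists of $n_1+\cdots+n_{k-1}$ zeros, followed by $t_k$, followed by $n_{k+1}+\cdots+n_d$ zeros. *)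

theory Defs
  imports "HOL-Library.Function_Algebras" "HOL-Library.FuncSet" "HOL-Combinatorics.Permutations"
    Complex_Main
begin

text \<open>
  All indices are 1-based. The shape of an order-\<open>d\<close> tensor is a function \<open>n\<close> of which only
  \<open>n 1, \<dots>, n d\<close> matter. A multi-index \<open>(j\<^sub>1, \<dots>, j\<^sub>d)\<close> is an extensional function on \<open>{1..d}\<close>.
  A tensor is a real function on multi-indices that vanishes outside the index set of its shape.
  Hence equality of tensors of the same shape is equality of functions, and sums of tensors are the
  pointwise sums of \<open>Function_Algebras\<close>.
\<close>

definition tensor_index :: "nat \<Rightarrow> (nat \<Rightarrow> nat) \<Rightarrow> (nat \<Rightarrow> nat) set" where
  "tensor_index d n = (\<Pi>\<^sub>E k\<in>{1..d}. {1..n k})"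

definition tensors :: "nat \<Rightarrow> (nat \<Rightarrow> nat) \<Rightarrow> ((nat \<Rightarrow> nat) \<Rightarrow> real) set" where
  "tensors d n = {A. \<forall>j. j \<notin> tensor_index d n \<longrightarrow> A j = 0}"

text \<open>A vector in \<open>\<real>\<^sup>m\<close> is a function on \<open>nat\<close> of which only the values at \<open>1, \<dots>, m\<close> are used.\<close>

definition outer :: "nat \<Rightarrow> (nat \<Rightarrow> nat) \<Rightarrow> (nat \<Rightarrow> nat \<Rightarrow> real) \<Rightarrow> (nat \<Rightarrow> nat) \<Rightarrow> real" where
  "outer d n t = (\<lambda>j. if j \<in> tensor_index d n then \<Prod>k=1..d. t k (j k) else 0)"

text \<open>
  The defining equation \<open>A\<^sup><\<^sup>p\<^sup>>(j\<^bsub>p 1\<^esub>, \<dots>, j\<^bsub>p d\<^esub>) = A(j\<^sub>1, \<dots>, j\<^sub>d)\<close> reads \<open>A\<^sup><\<^sup>p\<^sup>> (j \<circ> p) = A j\<close>,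
  and here it is solved for \<open>A\<^sup><\<^sup>p\<^sup>>\<close>. As \<open>p permutes {1..d}\<close> fixes everything outside \<open>{1..d}\<close>,
  composition with \<open>p\<close> preserves extensionality.
\<close>

definition tensor_transpose ::
    "(nat \<Rightarrow> nat) \<Rightarrow> ((nat \<Rightarrow> nat) \<Rightarrow> real) \<Rightarrow> (nat \<Rightarrow> nat) \<Rightarrow> real" where
  "tensor_transpose p A = (\<lambda>i. A (i \<circ> inv p))"

definition offset :: "(nat \<Rightarrow> nat) \<Rightarrow> nat \<Rightarrow> nat" where
  "offset n k = (\<Sum>l\<in>{1..<k}. n l)"

definition total_dim :: "nat \<Rightarrow> (nat \<Rightarrow> nat) \<Rightarrow> nat" where
  "total_dim d n = (\<Sum>k=1..d. n k)"

definition block_range :: "(nat \<Rightarrow> nat) \<Rightarrow> nat \<Rightarrow> nat set" where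
  "block_range n k = {1 + offset n k .. offset n k + n k}"

definition block_number :: "nat \<Rightarrow> (nat \<Rightarrow> nat) \<Rightarrow> nat \<Rightarrow> nat" where
  "block_number d n c = (THE k. k \<in> {1..d} \<and> c \<in> block_range n k)"

text \<open>
  The tuple \<open>i\<close> of block numbers is continued by the identity outside \<open>{1..d}\<close>, so that it is a
  permutation of \<open>1, \<dots>, d\<close> iff \<open>i permutes {1..d}\<close>.
\<close>

definition tensor_sym ::
    "nat \<Rightarrow> (nat \<Rightarrow> nat) \<Rightarrow> ((nat \<Rightarrow> nat) \<Rightarrow> real) \<Rightarrow> (nat \<Rightarrow> nat) \<Rightarrow> real" where
  "tensor_sym d n A = (\<lambda>J.
     if J \<in> tensor_index d (\<lambda>_. total_dim d n) then
       (let i = (\<lambda>k. if k \<in> {1..d} then block_number d n (J k) else k) in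
        if i permutes {1..d}
        then tensor_transpose i A (\<lambda>k\<in>{1..d}. J k - offset n (i k))
        else 0)
     else 0)"

text \<open>The block \<open>C(r\<^bsub>i 1\<^esub>, \<dots>, r\<^bsub>i d\<^esub>)\<close>, see \<open>tensor_block_tensor_sym\<close> below.\<close>

definition tensor_block ::
    "nat \<Rightarrow> (nat \<Rightarrow> nat) \<Rightarrow> (nat \<Rightarrow> nat) \<Rightarrow> ((nat \<Rightarrow> nat) \<Rightarrow> real) \<Rightarrow> (nat \<Rightarrow> nat) \<Rightarrow> real" where
  "tensor_block d n i C = (\<lambda>j. if j \<in> tensor_index d (n \<circ> i)
     then C (\<lambda>k\<in>{1..d}. offset n (i k) + j k) else 0)"

definition pad :: "(nat \<Rightarrow> nat) \<Rightarrow> nat \<Rightarrow> (nat \<Rightarrow> real) \<Rightarrow> nat \<Rightarrow> real" where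
  "pad n k t = (\<lambda>c. if c \<in> block_range n k then t (c - offset n k) else 0)"

text \<open>
  The factors \<open>t\<close> are not determined by \<open>T\<close>, but the result is; see \<open>tensor_pi_outer\<close> below.
\<close>

definition tensor_pi ::
    "nat \<Rightarrow> (nat \<Rightarrow> nat) \<Rightarrow> ((nat \<Rightarrow> nat) \<Rightarrow> real) \<Rightarrow> (nat \<Rightarrow> nat) \<Rightarrow> real" where
  "tensor_pi d n T = (THE S. \<exists>t. T = outer d n t \<and>
     S = outer d (\<lambda>_. total_dim d n) (\<lambda>k. pad n k (t k)))"

lemma tensor_transpose_apply:
  assumes "p permutes {1..d}"
  shows "tensor_transpose p A (j \<circ> p) = A j"
  using permutes_inv_o(1)[OF assms] by (simp add: tensor_transpose_def comp_assoc)

lemma tensor_transpose_in_tensors: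
  assumes p: "p permutes {1..d}" and A: "A \<in> tensors d n"
  shows "tensor_transpose p A \<in> tensors d (n \<circ> p)"
proof -
  have "j \<in> tensor_index d (n \<circ> p)" if "j \<circ> inv p \<in> tensor_index d n" for j
  proof -
    have j: "j k = (j \<circ> inv p) (p k)" for k
      using permutes_inverses(2)[OF p] by simp
    show ?thesis
      unfolding tensor_index_def
    proof (rule PiE_I)
      fix k assume "k \<in> {1..d}"
      then have "p k \<in> {1..d}" using permutes_in_image[OF p] by blast
      with that show "j k \<in> {1..(n \<circ> p) k}"
        unfolding tensor_index_def by (subst j) (metis PiE_mem comp_apply)
    next
      fix k assume "k \<notin> {1..d}"
      then have "p k \<notin> {1..d}" using permutes_in_image[OF p] by blast
      with that show "j k = undefined"
        unfolding tensor_index_def by (subst j) (metis PiE_arb)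
    qed
  qed
  with A show ?thesis
    unfolding tensors_def tensor_transpose_def by blast
qed

lemma offset_Suc: "1 \<le> k \<Longrightarrow> offset n (Suc k) = offset n k + n k"
  by (simp add: offset_def)

lemma offset_mono: "k \<le> l \<Longrightarrow> offset n k \<le> offset n l"
  unfolding offset_def by (rule sum_mono2) auto

lemma block_range_disjoint:
  assumes "1 \<le> k" "1 \<le> l" "c \<in> block_range n k" "c \<in> block_range n l"
  shows "k = l"
proof -
  have *: "\<not> k < l" if "1 \<le> k" "c \<in> block_range n k" "c \<in> block_range n l" for k l
    using that offset_mono[of "Suc k" l n] offset_Suc[of k n]
    by (auto simp: block_range_def)
  from *[of k l] *[of l k] assms show ?thesis by force
qed

lemma block_number_eqI:
  assumes "k \<in> {1..d}" "c \<in> block_range n k"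
  shows "block_number d n c = k"
  unfolding block_number_def
  using assms block_range_disjoint[of _ k c n] by (intro the_equality) auto

lemma block_range_subset:
  assumes "k \<in> {1..d}"
  shows "block_range n k \<subseteq> {1..total_dim d n}"
proof -
  have "offset n (Suc d) = total_dim d n"
    by (simp add: offset_def total_dim_def atLeastLessThanSuc_atLeastAtMost)
  with assms offset_mono[of "Suc k" "Suc d" n] offset_Suc[of k n] show ?thesis
    by (auto simp: block_range_def)
qed

lemma block_range_cover: "(\<Union>k\<in>{1..d}. block_range n k) = {1..total_dim d n}"
proof (induction d)
  case 0
  show ?case by (simp add: total_dim_def)
next
  case (Suc d)
  have *: "offset n (Suc d) = total_dim d n"
    by (simp add: offset_def total_dim_def atLeastLessThanSuc_atLeastAtMost)
  have "total_dim (Suc d) n = total_dim d n + n (Suc d)"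
    by (simp add: total_dim_def)
  with * have "{1..total_dim (Suc d) n} = {1..total_dim d n} \<union> block_range n (Suc d)"
    by (auto simp: block_range_def)
  with Suc show ?case by (simp add: atLeastAtMostSuc_conv Un_commute)
qed

lemma tensor_block_tensor_sym:
  assumes A: "A \<in> tensors d n"
    and i: "i ` {1..d} \<subseteq> {1..d}" "\<And>k. k \<notin> {1..d} \<Longrightarrow> i k = k"
  shows "tensor_block d n i (tensor_sym d n A) =
    (if i permutes {1..d} then tensor_transpose i A else 0)"
proof
  fix j
  show "tensor_block d n i (tensor_sym d n A) j =
    (if i permutes {1..d} then tensor_transpose i A else 0) j"
  proof (cases "j \<in> tensor_index d (n \<circ> i)")
    case False
    then have "tensor_transpose i A j = 0" if "i permutes {1..d}"
      using tensor_transpose_in_tensors[OF that A] by (auto simp: tensors_def)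
    with False show ?thesis by (auto simp: tensor_block_def)
  next
    case True
    define J where "J = (\<lambda>k\<in>{1..d}. offset n (i k) + j k)"
    have J: "J k \<in> block_range n (i k)" "i k \<in> {1..d}" if "k \<in> {1..d}" for k
    proof -
      show "i k \<in> {1..d}" using that i(1) by blast
      show "J k \<in> block_range n (i k)"
        using that True by (auto simp: J_def block_range_def tensor_index_def PiE_iff)
    qed
    have "J \<in> tensor_index d (\<lambda>_. total_dim d n)"
      using J block_range_subset[of _ d n] unfolding tensor_index_def PiE_iff
      by (auto simp: J_def simp del: atLeastAtMost_iff)
    moreover have i_eq: "(\<lambda>k. if k \<in> {1..d} then block_number d n (J k) else k) = i"
      using block_number_eqI[OF J(2,1)] i(2) by auto
    moreover have "(\<lambda>k\<in>{1..d}. J k - offset n (i k)) = j"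
      using True by (auto simp: J_def tensor_index_def PiE_iff extensional_def)
    ultimately have "tensor_sym d n A J = (if i permutes {1..d} then tensor_transpose i A j else 0)"
      unfolding tensor_sym_def i_eq by (simp add: Let_def)
    moreover have "tensor_block d n i (tensor_sym d n A) j = tensor_sym d n A J"
      using True by (simp only: tensor_block_def J_def if_True)
    ultimately show ?thesis by simp
  qed
qed

lemma outer_pad_apply:
  "outer d (\<lambda>_. total_dim d n) (\<lambda>k. pad n k (t k)) J =
    (if J \<in> extensional {1..d} \<and> (\<forall>k\<in>{1..d}. J k \<in> block_range n k)
     then outer d n t (\<lambda>k\<in>{1..d}. J k - offset n k) else 0)"
proof (cases "J \<in> extensional {1..d} \<and> (\<forall>k\<in>{1..d}. J k \<in> block_range n k)")
  case True
  then have "J \<in> tensor_index d (\<lambda>_. total_dim d n)"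
    using block_range_subset[of _ d n] unfolding tensor_index_def PiE_iff by blast
  moreover have "(\<lambda>k\<in>{1..d}. J k - offset n k) \<in> tensor_index d n"
    using True by (auto simp: tensor_index_def PiE_iff block_range_def)
  ultimately show ?thesis
    using True by (simp add: outer_def pad_def)
next
  case False
  then show ?thesis
    by (auto simp: outer_def pad_def tensor_index_def PiE_iff prod_zero_iff)
qed

lemma tensor_pi_outer:
  "tensor_pi d n (outer d n t) = outer d (\<lambda>_. total_dim d n) (\<lambda>k. pad n k (t k))"
  unfolding tensor_pi_def
proof (rule the_equality)
  fix S
  assume "\<exists>t'. outer d n t = outer d n t' \<and>
    S = outer d (\<lambda>_. total_dim d n) (\<lambda>k. pad n k (t' k))"
  then show "S = outer d (\<lambda>_. total_dim d n) (\<lambda>k. pad n k (t k))"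
    by (auto simp: outer_pad_apply)
qed blast

end

theory Submission
  imports Defs
begin

text \<open>
  Evaluated at a multi-index \<open>J\<close>, the summand belonging to \<open>p\<close> can only be nonzero if each \<open>J k\<close>
  lies in the block range number \<open>p k\<close>. Hence at most one permutation contributes, namely the tuple
  of block numbers of \<open>J\<close> (if that is a permutation), and its contribution is the entry of
  \<open>sym(A)\<close> at \<open>J\<close>.
\<close>

lemma sum_fun_apply: "(\<Sum>i\<in>I. f i) x = (\<Sum>i\<in>I. f i x)"
  by (induction I rule: infinite_finite_induct) auto

lemma comp_inv_in_extensional_iff:
  assumes "p permutes S"
  shows "f \<circ> inv p \<in> extensional S \<longleftrightarrow> f \<in> extensional S"
  using permutes_inverses[OF assms] permutes_in_image[OF assms]
    permutes_in_image[OF permutes_inv[OF assms]]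
  unfolding extensional_def by (auto, metis)

text \<open>Substitute \<open>p k\<close> for \<open>k\<close>. This moves the permutation from the
  position in \<open>J\<close> to the number of the block range.\<close>

lemma ball_comp_inv_iff:
  assumes "p permutes S"
  shows "(\<forall>k\<in>S. P (f (inv p k)) k) \<longleftrightarrow> (\<forall>k\<in>S. P (f k) (p k))"
  using permutes_inverses[OF assms] permutes_in_image[OF assms]
    permutes_in_image[OF permutes_inv[OF assms]]
  by metis

lemma mem_block_range_block_number:
  assumes "c \<in> {1..total_dim d n}"
  shows "c \<in> block_range n (block_number d n c)"
proof -
  obtain k where "k \<in> {1..d}" "c \<in> block_range n k"
    using assms block_range_cover[where d = d and n = n] by blast
  with block_number_eqI[OF this] show ?thesis by simp
qed

text \<open>Left to right, disjointness of the block ranges forces \<open>p k\<close> to be the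
  block number of \<open>J k\<close>; right to left, the ranges cover all indices up to
  \<open>total_dim d n\<close>, so each \<open>J k\<close> lies in the range with its block
  number.\<close>

lemma mem_block_ranges_iff:
  assumes p: "p permutes {1..d}"
  shows "J \<in> extensional {1..d} \<and> (\<forall>k\<in>{1..d}. J k \<in> block_range n (p k)) \<longleftrightarrow>
    J \<in> tensor_index d (\<lambda>_. total_dim d n) \<and>
    p = (\<lambda>k. if k \<in> {1..d} then block_number d n (J k) else k)"
    (is "?L \<longleftrightarrow> ?J \<and> p = ?i")
proof
  assume L: ?L
  have pk: "p k \<in> {1..d}" if "k \<in> {1..d}" for k
    using that permutes_in_image[OF p] by blast
  have ?J
    using L pk block_range_subset[of _ d n] unfolding tensor_index_def PiE_iff by blast
  \<comment> \<open>Outside \<open>{1..d}\<close> both sides are the identity, so the two agree as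
    functions.\<close>
  moreover have "p k = ?i k" for k
    using L pk block_number_eqI[of "p k" d "J k" n] permutes_not_in[OF p, of k] by auto
  ultimately show "?J \<and> p = ?i" by blast
next
  assume R: "?J \<and> p = ?i"
  have "J k \<in> block_range n (p k)" if "k \<in> {1..d}" for k
  proof -
    have "p k = block_number d n (J k)"
      using R that by metis
    with R that show ?thesis
      using mem_block_range_block_number[of "J k" d n] by (simp add: tensor_index_def PiE_iff)
  qed
  with R show ?L by (auto simp: tensor_index_def PiE_iff)
qed

text \<open>Whether \<open>J\<close> lies in the block selected by \<open>p\<close> does not depend
  on \<open>i\<close>. Hence the case distinction leaves the sum, and by linearity the sum passes
  inside the transposition, where it can be recognised as \<open>A\<close>.\<close>

lemma transpose_sum_tensor_pi_apply:
  fixes I :: "'a set"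
  assumes p: "p permutes {1..d}"
  shows "(\<Sum>i\<in>I. tensor_transpose p (tensor_pi d n (outer d n (u i))) J) =
    (if J \<in> tensor_index d (\<lambda>_. total_dim d n) \<and>
       p = (\<lambda>k. if k \<in> {1..d} then block_number d n (J k) else k)
     then tensor_transpose p (\<Sum>i\<in>I. outer d n (u i)) (\<lambda>k\<in>{1..d}. J k - offset n (p k)) else 0)"
    (is "_ = (if ?Q then _ else 0)")
proof -
  \<comment> \<open>Position \<open>k\<close> on the left is position \<open>inv p k\<close> of the
    shifted index, whose offset is that of block \<open>p (inv p k) = k\<close>.\<close>
  have "(\<lambda>k\<in>{1..d}. (J \<circ> inv p) k - offset n k) = (\<lambda>k\<in>{1..d}. J k - offset n (p k)) \<circ> inv p"
    using permutes_inverses(1)[OF p] permutes_in_image[OF permutes_inv[OF p]]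
    by (auto simp: fun_eq_iff restrict_def simp del: atLeastAtMost_iff)
  moreover have "J \<circ> inv p \<in> extensional {1..d} \<and>
      (\<forall>k\<in>{1..d}. (J \<circ> inv p) k \<in> block_range n k) \<longleftrightarrow> ?Q"
    unfolding mem_block_ranges_iff[OF p, symmetric] comp_inv_in_extensional_iff[OF p] comp_apply
    using ball_comp_inv_iff[OF p, of "\<lambda>c k. c \<in> block_range n k" J] by simp
  moreover have "(\<Sum>i\<in>I. if Q then g i else 0) = (if Q then sum g I else 0)"
    for Q and g :: "'a \<Rightarrow> real"
    by simp
  ultimately show ?thesis
    unfolding tensor_transpose_def tensor_pi_outer outer_pad_apply
    by (simp only: sum_fun_apply)
qed

theorem theorem6p3:
  fixes d r :: nat and n :: "nat \<Rightarrow> nat"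
    and A :: "(nat \<Rightarrow> nat) \<Rightarrow> real"
    and u :: "nat \<Rightarrow> nat \<Rightarrow> nat \<Rightarrow> real"
  assumes "A \<in> tensors d n"
    and "A = (\<Sum>i=1..r. outer d n (\<lambda>k. u k i))"
  shows "tensor_sym d n A =
    (\<Sum>p | p permutes {1..d}. \<Sum>i=1..r.
       tensor_transpose p (tensor_pi d n (outer d n (\<lambda>k. u k i))))"
proof
  fix J
  define b where "b = (\<lambda>k. if k \<in> {1..d} then block_number d n (J k) else k)"
  \<comment> \<open>Only the test \<open>p = b\<close> is kept out of \<open>F\<close>, so that the
    sum over permutations collapses to its term at \<open>b\<close>.\<close>
  define F where "F p = (if J \<in> tensor_index d (\<lambda>_. total_dim d n)
    then tensor_transpose p A (\<lambda>k\<in>{1..d}. J k - offset n (p k)) else 0)" for p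
  have "(\<Sum>p | p permutes {1..d}. \<Sum>i=1..r.
      tensor_transpose p (tensor_pi d n (outer d n (\<lambda>k. u k i)))) J =
    (\<Sum>p | p permutes {1..d}. if p = b then F p else 0)"
    unfolding sum_fun_apply
  proof (rule sum.cong[OF refl])
    fix p assume "p \<in> {p. p permutes {1..d}}"
    then have p: "p permutes {1..d}" by simp
    show "(\<Sum>i=1..r. tensor_transpose p (tensor_pi d n (outer d n (\<lambda>k. u k i))) J) =
      (if p = b then F p else 0)"
      unfolding transpose_sum_tensor_pi_apply[OF p, of n "\<lambda>i k. u k i"]
        assms(2)[symmetric] b_def[symmetric] F_def by simp
  qed
  \<comment> \<open>If \<open>b\<close> is not a permutation, no summand survives; this is the zero
    block of \<open>tensor_sym\<close>.\<close>
  also have "\<dots> = (if b permutes {1..d} then F b else 0)"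
    by (simp add: finite_permutations)
  also have "\<dots> = tensor_sym d n A J"
    unfolding tensor_sym_def F_def Let_def b_def by simp
  finally show "tensor_sym d n A J = (\<Sum>p | p permutes {1..d}. \<Sum>i=1..r.
      tensor_transpose p (tensor_pi d n (outer d n (\<lambda>k. u k i)))) J" ..
qed

end
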